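(* For every integer $n\ge 0$, $\mathrm{cp}_{1,1,2}(n)=\mathcal{EO}^*(2n)$.
   Context: A partition of a non-negative integer $n$ is a finite multiset of positive integers (its parts) with sum $n$; the empty multiset $\emptyset$ is the unique partition of $0$. The size $|\lambda|$ of a partition $\lambda$ is the sum of its parts. For integers $a,b,m\ge 1$, an $(a,b,m)$-copartition is a triple of partitions $(\gamma,\rho,\sigma)$ such that each part of $\gamma$ is at least $a$ and congruent to $a \pmod m$, each part of $\sigma$ is at least $b$ and congruent to $b\pmod m$, and $\rho$ has the same number of parts as $\sigma$, each of which has size equal to $m$ times the number of parts of $\gamma$ (if $\gamma$ is empty, $\rho$ is regarded as empty). Its size is $|\gamma|+|\rho|+|\sigma|$. Let $\mathrm{cp}_{a,b,m}(n)$ denote the number of $(a,b,m)$-copartitions of size $n$. $\mathcal{EO}^*(n)$ denotes the number of partitions of $n$ in which all even parts are smaller than all odd parts and the only part size appearing an odd number of times is the largest even part. That is: if there is at least one even part, then the largest even part appears an odd number of times and every other part size appears an even number of times; if there are no even parts, then every part size appears an even number of times. In particular $\mathcal{EO}^*(0)=1$. *)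

theory Defs
  imports "HOL-Library.Multiset" "HOL-Number_Theory.Cong"
begin

definition is_partition :: "nat multiset \<Rightarrow> bool" where
  "is_partition p \<longleftrightarrow> (\<forall>x\<in>#p. 0 < x)"

text \<open>
  The intended parameters satisfy \<open>a, b, m \<ge> 1\<close>.  When \<open>\<gamma>\<close> is empty,
  the parts of \<open>\<rho>\<close> would all be \<open>0\<close>; by convention \<open>\<rho>\<close> is then empty,
  whatever the number of parts of \<open>\<sigma>\<close>.
\<close>
definition is_copartition ::
    "nat \<Rightarrow> nat \<Rightarrow> nat \<Rightarrow> nat multiset \<times> nat multiset \<times> nat multiset \<Rightarrow> bool" where
  "is_copartition a b m = (\<lambda>(\<gamma>, \<rho>, \<sigma>).
     is_partition \<gamma> \<and> is_partition \<rho> \<and> is_partition \<sigma> \<and>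
     (\<forall>x\<in>#\<gamma>. a \<le> x \<and> [x = a] (mod m)) \<and>
     (\<forall>x\<in>#\<sigma>. b \<le> x \<and> [x = b] (mod m)) \<and>
     (if \<gamma> = {#} then \<rho> = {#}
      else size \<rho> = size \<sigma> \<and> (\<forall>x\<in>#\<rho>. x = m * size \<gamma>)))"

definition copartitions ::
    "nat \<Rightarrow> nat \<Rightarrow> nat \<Rightarrow> nat \<Rightarrow> (nat multiset \<times> nat multiset \<times> nat multiset) set" where
  "copartitions a b m n =
     {(\<gamma>, \<rho>, \<sigma>). is_copartition a b m (\<gamma>, \<rho>, \<sigma>) \<and>
                  sum_mset \<gamma> + sum_mset \<rho> + sum_mset \<sigma> = n}"

definition cp :: "nat \<Rightarrow> nat \<Rightarrow> nat \<Rightarrow> nat \<Rightarrow> nat" where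
  "cp a b m n = card (copartitions a b m n)"

definition is_EO_star :: "nat multiset \<Rightarrow> bool" where
  "is_EO_star p \<longleftrightarrow>
     (\<forall>x\<in>#p. \<forall>y\<in>#p. even x \<longrightarrow> odd y \<longrightarrow> x < y) \<and>
     (if \<exists>x\<in>#p. even x
      then odd (count p (Max {x \<in> set_mset p. even x})) \<and>
           (\<forall>x\<in>#p. x \<noteq> Max {x \<in> set_mset p. even x} \<longrightarrow> even (count p x))
      else \<forall>x\<in>#p. even (count p x))"

definition EO_star_partitions :: "nat \<Rightarrow> nat multiset set" where
  "EO_star_partitions n = {p. is_partition p \<and> sum_mset p = n \<and> is_EO_star p}"

definition EO_star :: "nat \<Rightarrow> nat" where
  "EO_star n = card (EO_star_partitions n)"

text \<open>The sets counted above are finite, so that \<open>card\<close> really counts.\<close>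

lemma size_le_sum_mset_partition: "is_partition p \<Longrightarrow> size p \<le> sum_mset p"
  by (induction p) (auto simp: is_partition_def)

lemma finite_partitions_le: "finite {p. is_partition p \<and> sum_mset p \<le> n}"
proof (rule finite_subset)
  show "{p. is_partition p \<and> sum_mset p \<le> n} \<subseteq> mset ` {xs. set xs \<subseteq> {..n} \<and> length xs \<le> n}"
  proof
    fix p :: "nat multiset"
    assume "p \<in> {p. is_partition p \<and> sum_mset p \<le> n}"
    then have p: "is_partition p" "sum_mset p \<le> n" by auto
    obtain xs where xs: "p = mset xs" by (metis ex_mset)
    have "x \<le> n" if "x \<in> set xs" for x
      using p(2) member_le_sum_list[OF that] by (simp add: xs sum_mset_sum_list)
    moreover have "length xs \<le> n"
      using size_le_sum_mset_partition[OF p(1)] p(2) by (simp add: xs)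
    ultimately show "p \<in> mset ` {xs. set xs \<subseteq> {..n} \<and> length xs \<le> n}"
      by (auto simp: xs)
  qed
qed (intro finite_imageI finite_lists_length_le finite_atMost)

lemma finite_EO_star_partitions: "finite (EO_star_partitions n)"
  by (rule finite_subset[OF _ finite_partitions_le[of n]]) (auto simp: EO_star_partitions_def)

lemma finite_copartitions: "finite (copartitions a b m n)"
proof -
  let ?P = "{p. is_partition p \<and> sum_mset p \<le> n}"
  have "copartitions a b m n \<subseteq> ?P \<times> ?P \<times> ?P"
    by (auto simp: copartitions_def is_copartition_def)
  then show ?thesis
    by (rule finite_subset) (intro finite_cartesian_product finite_partitions_le)
qed

end

theory Submission
  imports Defs
begin

text \<open>
  Both sides count the same data: a number \<open>g\<close>, a partition whose parts are all odd and exceed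
  \<open>2 * g\<close>, and a partition fitting into a strip of width \<open>g\<close>.

  In a \<open>(1, 1, 2)\<close>-copartition \<open>(\<gamma>, \<rho>, \<sigma>)\<close> let \<open>g\<close> be the number of parts of \<open>\<gamma>\<close>.  Adding the
  parts of \<open>\<rho>\<close>, all equal to \<open>2 * g\<close>, to those of \<open>\<sigma>\<close> gives an arbitrary partition \<open>\<tau>\<close> into odd
  parts exceeding \<open>2 * g\<close>, and writing the parts of \<open>\<gamma>\<close> as \<open>2 * x + 1\<close> gives a multiset of exactly
  \<open>g\<close> natural numbers \<open>x\<close>.  In a partition counted by \<open>EO_star (2 * n)\<close> let \<open>2 * g\<close> be the largest
  even part (\<open>g = 0\<close> if there is none).  After one copy of it is removed, all multiplicities
  are even; halving them leaves even parts \<open>2 * y\<close> with \<open>1 \<le> y \<le> g\<close>, and a partition \<open>\<tau>\<close> into odd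
  parts exceeding \<open>2 * g\<close>.

  The sizes agree: if the \<open>x\<close> (or the \<open>y\<close>) have sum \<open>j\<close>, then \<open>\<tau>\<close> has sum \<open>n - (g + 2 * j)\<close>
  in both cases.  It remains to see that multisets of \<open>g\<close> natural numbers with sum \<open>j\<close> are
  equinumerous with partitions of \<open>j\<close> into parts at most \<open>g\<close>.  This is conjugation of partitions;
  here it follows from a recurrence common to the two numbers (\<open>card_sized_eq_card_bounded\<close>).
\<close>

section \<open>Partitions with at most g parts and partitions with parts at most g\<close>

text \<open>
  A multiset of \<open>g\<close> natural numbers, zeros allowed, encodes a partition into at most \<open>g\<close> parts.
\<close>
definition sized_msets :: "nat \<Rightarrow> nat \<Rightarrow> nat multiset set" where
  "sized_msets g j = {c. size c = g \<and> sum_mset c = j}"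

text \<open>Partitions of \<open>j\<close> into parts at most \<open>g\<close>.\<close>
definition bounded_partitions :: "nat \<Rightarrow> nat \<Rightarrow> nat multiset set" where
  "bounded_partitions g j = {d. set_mset d \<subseteq> {1..g} \<and> sum_mset d = j}"

lemma finite_sized_msets: "finite (sized_msets g j)"
proof (rule finite_subset)
  show "sized_msets g j \<subseteq> mset ` {xs. set xs \<subseteq> {..j} \<and> length xs = g}"
  proof
    fix c assume c: "c \<in> sized_msets g j"
    obtain xs where xs: "c = mset xs" by (metis ex_mset)
    have "x \<le> j" if "x \<in> set xs" for x
      using c member_le_sum_list[OF that] by (simp add: xs sized_msets_def sum_mset_sum_list)
    then show "c \<in> mset ` {xs. set xs \<subseteq> {..j} \<and> length xs = g}"
      using c by (auto simp: xs sized_msets_def)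
  qed
qed (intro finite_imageI finite_lists_length_eq finite_atMost)

lemma finite_bounded_partitions: "finite (bounded_partitions g j)"
  by (rule finite_subset[OF _ finite_partitions_le[of j]])
     (auto simp: bounded_partitions_def is_partition_def)

lemma sum_mset_image_Suc: "sum_mset (image_mset Suc c) = sum_mset c + size c"
  by (induction c) auto

text \<open>
  A multiset of \<open>Suc g\<close> naturals either contains \<open>0\<close>, which can be removed, or all its elements
  can be decreased by \<open>1\<close>.
\<close>
lemma sized_msets_Suc:
  "sized_msets (Suc g) j = add_mset 0 ` sized_msets g j \<union>
     (if Suc g \<le> j then image_mset Suc ` sized_msets (Suc g) (j - Suc g) else {})"
  (is "?L = ?R")
proof
  show "?L \<subseteq> ?R"
  proof
    fix c assume c: "c \<in> ?L"
    show "c \<in> ?R"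
    proof (cases "0 \<in># c")
      case True
      then obtain c' where "c = add_mset 0 c'" by (metis mset_add)
      then show ?thesis using c by (auto simp: sized_msets_def)
    next
      case False
      define c' where "c' = image_mset (\<lambda>x. x - 1) c"
      have "image_mset Suc c' = image_mset id c"
        unfolding c'_def image_mset.compositionality
        by (rule image_mset_cong) (use False in \<open>auto simp: gr0_conv_Suc intro!: Suc_pred gr0I\<close>)
      then have eq: "c = image_mset Suc c'" by simp
      then have "sum_mset c = sum_mset c' + size c'" "size c = size c'"
        by (simp_all add: sum_mset_image_Suc)
      then show ?thesis using c eq by (auto simp: sized_msets_def)
    qed
  qed
  show "?R \<subseteq> ?L"
    by (auto simp: sized_msets_def sum_mset_image_Suc split: if_splits)
qed

text \<open>A partition into parts at most \<open>Suc g\<close> either has no part \<open>Suc g\<close>, or one can be removed.\<close>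
lemma bounded_partitions_Suc:
  "bounded_partitions (Suc g) j = bounded_partitions g j \<union>
     (if Suc g \<le> j then add_mset (Suc g) ` bounded_partitions (Suc g) (j - Suc g) else {})"
  (is "?L = ?R")
proof
  show "?L \<subseteq> ?R"
  proof
    fix d assume d: "d \<in> ?L"
    show "d \<in> ?R"
    proof (cases "Suc g \<in># d")
      case True
      then obtain d' where "d = add_mset (Suc g) d'" by (metis mset_add)
      then show ?thesis using d by (auto simp: bounded_partitions_def)
    next
      case False
      then show ?thesis
        using d by (auto simp: bounded_partitions_def atLeastAtMostSuc_conv)
    qed
  qed
  show "?R \<subseteq> ?L"
    by (force simp: bounded_partitions_def split: if_splits)
qed

lemma card_sized_eq_card_bounded:
  "card (sized_msets g j) = card (bounded_partitions g j)"
proof (induction g arbitrary: j)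
  case 0
  have "sized_msets 0 j = bounded_partitions 0 j"
    by (auto simp: sized_msets_def bounded_partitions_def)
  then show ?case by simp
next
  case (Suc g)
  note outer = Suc.IH
  show ?case
  proof (induction j rule: less_induct)
    case (less j)
    let ?A = "if Suc g \<le> j then image_mset Suc ` sized_msets (Suc g) (j - Suc g) else {}"
    let ?B = "if Suc g \<le> j then add_mset (Suc g) ` bounded_partitions (Suc g) (j - Suc g) else {}"
    have "inj_on (image_mset Suc) X" for X
      by (rule inj_on_subset[OF multiset.inj_map[OF inj_Suc] subset_UNIV])
    moreover have "inj_on (add_mset (Suc g)) X" for X
      by (simp add: inj_on_def)
    ultimately have "card ?A = card ?B"
      using less.IH[of "j - Suc g"] by (simp add: card_image)
    moreover have "card (add_mset 0 ` sized_msets g j) = card (bounded_partitions g j)"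
      using outer[of j] by (simp add: card_image inj_on_def)
    moreover have "card (sized_msets (Suc g) j) = card (add_mset 0 ` sized_msets g j) + card ?A"
    proof -
      have "0 \<in># c" if "c \<in> add_mset 0 ` sized_msets g j" for c
        using that by auto
      moreover have "0 \<notin># c" if "c \<in> ?A" for c
        using that by (auto split: if_splits)
      ultimately have "add_mset 0 ` sized_msets g j \<inter> ?A = {}" by blast
      then show ?thesis
        unfolding sized_msets_Suc[of g j]
        by (intro card_Un_disjoint) (simp_all add: finite_sized_msets)
    qed
    moreover have "card (bounded_partitions (Suc g) j) = card (bounded_partitions g j) + card ?B"
    proof -
      have "Suc g \<notin># d" if "d \<in> bounded_partitions g j" for d
        using that by (auto simp: bounded_partitions_def)
      moreover have "Suc g \<in># d" if "d \<in> ?B" for d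
        using that by (auto split: if_splits)
      ultimately have "bounded_partitions g j \<inter> ?B = {}" by blast
      then show ?thesis
        unfolding bounded_partitions_Suc[of g j]
        by (intro card_Un_disjoint) (simp_all add: finite_bounded_partitions)
    qed
    ultimately show ?case by simp
  qed
qed

section \<open>Decomposition of copartitions\<close>

text \<open>Partitions of \<open>r\<close> into odd parts exceeding \<open>2 * g\<close>.\<close>
definition odd_partitions_above :: "nat \<Rightarrow> nat \<Rightarrow> nat multiset set" where
  "odd_partitions_above g r = {t. (\<forall>x\<in>#t. odd x \<and> 2 * g < x) \<and> sum_mset t = r}"

lemma finite_odd_partitions_above: "finite (odd_partitions_above g r)"
proof (rule finite_subset[OF _ finite_partitions_le[of r]])
  show "odd_partitions_above g r \<subseteq> {p. is_partition p \<and> sum_mset p \<le> r}"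
    unfolding odd_partitions_above_def is_partition_def by (blast intro: odd_pos eq_imp_le)
qed

text \<open>
  The pairs \<open>(g, j)\<close> occurring for size \<open>n\<close>; the remaining \<open>n - (g + 2 * j)\<close> is the size of the
  partition into odd parts.
\<close>
definition index_pairs :: "nat \<Rightarrow> (nat \<times> nat) set" where
  "index_pairs n = {(g, j). g + 2 * j \<le> n}"

lemma finite_index_pairs: "finite (index_pairs n)"
  by (rule finite_subset[of _ "{..n} \<times> {..n}"]) (auto simp: index_pairs_def)

text \<open>
  The data shared by both sides of the identity; the family \<open>F\<close> is \<open>sized_msets\<close> for
  copartitions and \<open>bounded_partitions\<close> for the other side.
\<close>
definition decomps ::
    "(nat \<Rightarrow> nat \<Rightarrow> nat multiset set) \<Rightarrow> nat \<Rightarrow> ((nat \<times> nat) \<times> nat multiset \<times> nat multiset) set" where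
  "decomps F n = (SIGMA (g, j) : index_pairs n. F g j \<times> odd_partitions_above g (n - (g + 2 * j)))"

lemma mem_decomps:
  "((g, j), c, t) \<in> decomps F n \<longleftrightarrow>
     g + 2 * j \<le> n \<and> c \<in> F g j \<and> t \<in> odd_partitions_above g (n - (g + 2 * j))"
  by (auto simp: decomps_def index_pairs_def)

lemma card_decomps:
  assumes "\<And>g j. finite (F g j)"
  shows "card (decomps F n) =
    (\<Sum>(g, j)\<in>index_pairs n. card (F g j) * card (odd_partitions_above g (n - (g + 2 * j))))"
proof -
  let ?X = "\<lambda>(g, j). F g j \<times> odd_partitions_above g (n - (g + 2 * j))"
  have "\<forall>gj\<in>index_pairs n. finite (?X gj)"
    using assms by (simp add: finite_odd_partitions_above split: prod.split)
  then have "card (decomps F n) = (\<Sum>gj\<in>index_pairs n. card (?X gj))"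
    unfolding decomps_def by (rule card_SigmaI[OF finite_index_pairs])
  then show ?thesis by (simp add: case_prod_unfold card_cartesian_product)
qed

lemma sum_mset_image_double_Suc:
  "sum_mset (image_mset (\<lambda>x. 2 * x + 1) c) = 2 * sum_mset c + size (c :: nat multiset)"
  by (induction c) auto

lemma sum_mset_image_add:
  "sum_mset (image_mset (\<lambda>x. x + k) s) = sum_mset s + size s * (k :: nat)"
  by (induction s) auto

lemma sum_mset_image_double: "sum_mset (image_mset (\<lambda>x. 2 * x) d) = 2 * sum_mset (d :: nat multiset)"
  by (induction d) auto

text \<open>
  For \<open>\<gamma> = {#}\<close> the convention \<open>\<rho> = {#}\<close> replaces \<open>\<rho>\<close> consisting of zeros; either way \<open>\<sigma>\<close> is
  recovered from \<open>\<tau>\<close> by subtracting \<open>2 * size \<gamma>\<close> from each part.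
\<close>
lemma card_copartitions_eq_card_decomps:
  "card (copartitions 1 1 2 n) = card (decomps sized_msets n)"
proof -
  define f :: "nat multiset \<times> nat multiset \<times> nat multiset \<Rightarrow> (nat \<times> nat) \<times> nat multiset \<times> nat multiset"
    where "f = (\<lambda>(\<gamma>, \<rho>, \<sigma>). let c = image_mset (\<lambda>x. x div 2) \<gamma>
      in ((size \<gamma>, sum_mset c), c, image_mset (\<lambda>x. x + 2 * size \<gamma>) \<sigma>))"
  define h :: "(nat \<times> nat) \<times> nat multiset \<times> nat multiset \<Rightarrow> nat multiset \<times> nat multiset \<times> nat multiset"
    where "h = (\<lambda>((g, j), c, t). (image_mset (\<lambda>x. 2 * x + 1) c,
      (if g = 0 then {#} else replicate_mset (size t) (2 * g)), image_mset (\<lambda>x. x - 2 * g) t))"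
  have odd_part: "image_mset (\<lambda>x. 2 * x + 1) (image_mset (\<lambda>x. x div 2) \<gamma>) = \<gamma>"
    if "\<forall>x\<in>#\<gamma>. odd x" for \<gamma> :: "nat multiset"
  proof -
    have "image_mset (\<lambda>x. 2 * x + 1) (image_mset (\<lambda>x. x div 2) \<gamma>) = image_mset id \<gamma>"
      unfolding image_mset.compositionality by (rule image_mset_cong) (use that in auto)
    then show ?thesis by simp
  qed
  have shift: "image_mset (\<lambda>x. x + k) (image_mset (\<lambda>x. x - k) t) = t"
    if "\<forall>x\<in>#t. k < x" for t and k :: nat
  proof -
    have "image_mset (\<lambda>x. x + k) (image_mset (\<lambda>x. x - k) t) = image_mset id t"
      unfolding image_mset.compositionality
      by (rule image_mset_cong) (use that in \<open>auto simp: less_imp_le\<close>)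
    then show ?thesis by simp
  qed
  have cop: "(\<gamma>, \<rho>, \<sigma>) \<in> copartitions 1 1 2 n \<longleftrightarrow>
      (\<forall>x\<in>#\<gamma>. odd x) \<and> (\<forall>x\<in>#\<sigma>. odd x) \<and>
      \<rho> = (if \<gamma> = {#} then {#} else replicate_mset (size \<sigma>) (2 * size \<gamma>)) \<and>
      sum_mset \<gamma> + 2 * size \<gamma> * size \<sigma> + sum_mset \<sigma> = n" for \<gamma> \<rho> \<sigma>
  proof -
    have rep: "\<rho> = replicate_mset k v \<longleftrightarrow> size \<rho> = k \<and> (\<forall>x\<in>#\<rho>. x = v)" for k and v :: nat
      by (metis in_replicate_mset set_mset_replicate_mset_subset size_replicate_mset
          set_mset_subset_singletonD singletonD subsetI singletonI)
    have odd_iff: "odd x \<longleftrightarrow> 0 < x \<and> 1 \<le> x \<and> [x = 1] (mod 2)" for x :: nat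
      by (auto simp: cong_def odd_iff_mod_2_eq_one intro: odd_pos)
    have parts: "is_partition p \<and> (\<forall>x\<in>#p. 1 \<le> x \<and> [x = 1] (mod 2)) \<longleftrightarrow> (\<forall>x\<in>#p. odd x)" for p
      unfolding is_partition_def odd_iff by blast
    let ?\<rho> = "if \<gamma> = {#} then {#} else replicate_mset (size \<sigma>) (2 * size \<gamma>)"
    have \<rho>_iff: "(if \<gamma> = {#} then \<rho> = {#} else size \<rho> = size \<sigma> \<and> (\<forall>x\<in>#\<rho>. x = 2 * size \<gamma>))
        \<longleftrightarrow> \<rho> = ?\<rho>"
      using rep[of "size \<sigma>" "2 * size \<gamma>"] by (cases "\<gamma> = {#}") simp_all
    have \<rho>_part: "is_partition ?\<rho>" and \<rho>_sum: "sum_mset ?\<rho> = 2 * size \<gamma> * size \<sigma>"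
      by (simp_all add: is_partition_def nonempty_has_size)
    have "(\<gamma>, \<rho>, \<sigma>) \<in> copartitions 1 1 2 n \<longleftrightarrow>
        (\<forall>x\<in>#\<gamma>. odd x) \<and> (\<forall>x\<in>#\<sigma>. odd x) \<and> is_partition \<rho> \<and> \<rho> = ?\<rho> \<and>
        sum_mset \<gamma> + sum_mset \<rho> + sum_mset \<sigma> = n"
      unfolding copartitions_def is_copartition_def mem_Collect_eq prod.case \<rho>_iff parts[symmetric]
      by blast
    then show ?thesis
      by (cases "\<rho> = ?\<rho>") (simp_all only: \<rho>_part \<rho>_sum simp_thms)
  qed
  have "bij_betw f (copartitions 1 1 2 n) (decomps sized_msets n)"
  proof (rule bij_betw_byWitness[where f' = h])
    show "\<forall>a\<in>copartitions 1 1 2 n. h (f a) = a"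
    proof
      fix a assume "a \<in> copartitions 1 1 2 n"
      moreover obtain \<gamma> \<rho> \<sigma> where a: "a = (\<gamma>, \<rho>, \<sigma>)" by (metis prod.exhaust)
      ultimately have \<gamma>: "\<forall>x\<in>#\<gamma>. odd x"
        and \<rho>: "\<rho> = (if \<gamma> = {#} then {#} else replicate_mset (size \<sigma>) (2 * size \<gamma>))"
        unfolding a cop by blast+
      have "image_mset (\<lambda>x. x - k) (image_mset (\<lambda>x. x + k) \<sigma>) = \<sigma>" for k
        by (simp add: image_mset.compositionality o_def)
      then show "h (f a) = a"
        by (simp only: a f_def h_def Let_def prod.case odd_part[OF \<gamma>] \<rho> size_image_mset size_eq_0_iff_empty)
    qed
    show "\<forall>b\<in>decomps sized_msets n. f (h b) = b"
    proof
      fix b assume b: "b \<in> decomps sized_msets n"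
      obtain g j c t where b': "b = ((g, j), c, t)" by (metis prod.exhaust)
      have c: "size c = g" "sum_mset c = j" and t: "\<forall>x\<in>#t. 2 * g < x"
        using b unfolding b' mem_decomps sized_msets_def odd_partitions_above_def by blast+
      have "image_mset (\<lambda>x. x div 2) (image_mset (\<lambda>x. 2 * x + 1) c) = c"
        by (simp add: image_mset.compositionality o_def)
      then show "f (h b) = b"
        by (simp only: b' f_def h_def Let_def prod.case c shift[OF t] size_image_mset)
    qed
    show "f ` copartitions 1 1 2 n \<subseteq> decomps sized_msets n"
    proof
      fix y assume "y \<in> f ` copartitions 1 1 2 n"
      then obtain \<gamma> \<rho> \<sigma> where mem: "(\<gamma>, \<rho>, \<sigma>) \<in> copartitions 1 1 2 n" and y: "y = f (\<gamma>, \<rho>, \<sigma>)"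
        by auto
      have \<gamma>: "\<forall>x\<in>#\<gamma>. odd x" and \<sigma>: "\<forall>x\<in>#\<sigma>. odd x"
        and n: "n = sum_mset \<gamma> + 2 * size \<gamma> * size \<sigma> + sum_mset \<sigma>"
        using mem unfolding cop by blast+
      have "sum_mset \<gamma> = 2 * sum_mset (image_mset (\<lambda>x. x div 2) \<gamma>) + size \<gamma>"
        using sum_mset_image_double_Suc[of "image_mset (\<lambda>x. x div 2) \<gamma>"] odd_part[OF \<gamma>] by simp
      moreover have "\<forall>x\<in>#image_mset (\<lambda>x. x + 2 * size \<gamma>) \<sigma>. odd x \<and> 2 * size \<gamma> < x"
        using \<sigma> by (auto intro: odd_pos)
      ultimately show "y \<in> decomps sized_msets n"
        unfolding y f_def Let_def prod.case mem_decomps sized_msets_def odd_partitions_above_def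
        by (simp add: n sum_mset_image_add)
    qed
    show "h ` decomps sized_msets n \<subseteq> copartitions 1 1 2 n"
    proof
      fix y assume "y \<in> h ` decomps sized_msets n"
      then obtain g j c t where mem: "((g, j), c, t) \<in> decomps sized_msets n"
        and y: "y = h ((g, j), c, t)" by auto
      have c: "size c = g" "sum_mset c = j" and t: "\<forall>x\<in>#t. odd x \<and> 2 * g < x"
        and n: "n = g + 2 * j + sum_mset t"
        using mem unfolding mem_decomps sized_msets_def odd_partitions_above_def by auto
      have "sum_mset t = sum_mset (image_mset (\<lambda>x. x - 2 * g) t) + size t * (2 * g)"
        using sum_mset_image_add[of "2 * g" "image_mset (\<lambda>x. x - 2 * g) t"] shift[of t "2 * g"] t
        by simp
      then have total: "sum_mset (image_mset (\<lambda>x. 2 * x + 1) c) + 2 * g * size t +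
          sum_mset (image_mset (\<lambda>x. x - 2 * g) t) = n"
        unfolding sum_mset_image_double_Suc c n by (simp add: mult.commute)
      have empty: "image_mset (\<lambda>x. 2 * x + 1) c = {#} \<longleftrightarrow> g = 0"
        using c(1) by auto
      have "\<forall>x\<in>#image_mset (\<lambda>x. 2 * x + 1) c. odd x"
        by simp
      moreover have "\<forall>x\<in>#image_mset (\<lambda>x. x - 2 * g) t. odd x"
      proof -
        have "odd (x - 2 * g)" if "x \<in># t" for x
        proof -
          have "odd x" "2 * g \<le> x" using t that by (blast intro: less_imp_le)+
          then show ?thesis by (simp add: even_diff_nat)
        qed
        then show ?thesis by auto
      qed
      ultimately show "y \<in> copartitions 1 1 2 n"
        using empty total unfolding y h_def prod.case cop size_image_mset c(1) by simp
    qed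
  qed
  then show ?thesis by (rule bij_betw_same_card)
qed

section \<open>Decomposition of partitions whose even parts lie below their odd parts\<close>

lemma even_counts_imp_double:
  assumes "\<And>x. even (count p x)"
  obtains q where "p = q + q"
proof
  define q where "q = Abs_multiset (\<lambda>x. count p x div 2)"
  have "finite {x. 0 < count p x div 2}"
    by (rule finite_subset[of _ "set_mset p"]) (auto intro!: count_inI)
  then have "count q x = count p x div 2" for x
    by (simp add: q_def count_Abs_multiset)
  then show "p = q + q"
    using assms by (intro multiset_eqI) (auto simp flip: mult_2)
qed

lemma double_mset_inject: "q + q = q' + q' \<longleftrightarrow> q = (q' :: 'a multiset)"
  by (auto simp: multiset_eq_iff simp flip: mult_2)

text \<open>
  Half of the largest even part of a partition, with value \<open>0\<close> when there is no even part.
\<close>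
definition half_top :: "nat multiset \<Rightarrow> nat" where
  "half_top p = Max (insert 0 {x \<in> set_mset p. even x}) div 2"

text \<open>The one copy of the largest even part \<open>2 * g\<close> that is set aside; none if \<open>g = 0\<close>.\<close>
definition top_part :: "nat \<Rightarrow> nat multiset" where
  "top_part g = (if g = 0 then {#} else {#2 * g#})"

text \<open>
  Both cases of \<open>is_EO_star\<close> at once: \<open>q\<close> is the partition with halved multiplicities.  For
  \<open>g = 0\<close> the bound on even \<open>x\<close> excludes even parts, since parts are positive.
\<close>
lemma is_EO_star_iff:
  assumes "is_partition p"
  shows "is_EO_star p \<longleftrightarrow>
    (\<exists>g q. p = top_part g + (q + q) \<and> (\<forall>x\<in>#q. if even x then x \<le> 2 * g else 2 * g < x))"
    (is "?L \<longleftrightarrow> ?R")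
proof
  assume ?L
  let ?E = "{x \<in> set_mset p. even x}"
  show ?R
  proof (cases "\<exists>x\<in>#p. even x")
    case True
    define M where "M = Max ?E"
    have fin: "finite ?E" and ne: "?E \<noteq> {}" using True by auto
    have M: "M \<in># p" "even M" using Max_in[OF fin ne] by (auto simp: M_def)
    have le: "x \<le> M" if "x \<in># p" "even x" for x
      using that fin by (auto simp: M_def)
    obtain g where g: "M = 2 * g" using M(2) by (rule evenE)
    have "g > 0" using assms M(1) g by (auto simp: is_partition_def)
    obtain r where r: "p = add_mset M r" using M(1) by (metis mset_add)
    have cM: "odd (count p M)" and co: "\<And>x. x \<in># p \<Longrightarrow> x \<noteq> M \<Longrightarrow> even (count p x)"
      using \<open>?L\<close> True by (auto simp: is_EO_star_def M_def)
    have "even (count r x)" for x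
    proof (cases "x = M")
      case False
      then have "count r x = count p x" by (simp add: r)
      then show ?thesis using co[of x] False by (cases "x \<in># p") (auto simp: not_in_iff)
    qed (use cM r in simp)
    then obtain q where q: "r = q + q" by (rule even_counts_imp_double)
    have "p = top_part g + (q + q)" using r q g \<open>g > 0\<close> by (simp add: top_part_def)
    moreover have "if even x then x \<le> 2 * g else 2 * g < x" if "x \<in># q" for x
      using that le[of x] M \<open>?L\<close> by (auto simp: q r g is_EO_star_def)
    ultimately show ?R by blast
  next
    case False
    then have "even (count p x)" for x
      using \<open>?L\<close> by (cases "x \<in># p") (auto simp: is_EO_star_def not_in_iff)
    then obtain q where q: "p = q + q" by (rule even_counts_imp_double)
    then have "\<forall>x\<in>#q. if even x then x \<le> 2 * 0 else 2 * 0 < x"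
      using False assms by (auto simp: is_partition_def)
    then show ?R using q by (intro exI[of _ 0] exI[of _ q]) (auto simp: top_part_def)
  qed
next
  assume ?R
  then obtain g q where p: "p = top_part g + (q + q)"
    and q: "\<And>x. x \<in># q \<Longrightarrow> if even x then x \<le> 2 * g else 2 * g < x" by blast
  let ?E = "{x \<in> set_mset p. even x}"
  show ?L
  proof (cases "g = 0")
    case True
    have "odd x" if "x \<in># p" for x
      using that q[of x] assms True by (auto simp: p top_part_def is_partition_def split: if_splits)
    then show ?L by (auto simp: is_EO_star_def p top_part_def True)
  next
    case False
    have "Max ?E = 2 * g"
      by (rule Max_eqI) (use q False in \<open>auto simp: p top_part_def split: if_splits\<close>)
    moreover have "x < y" if "x \<in># p" "y \<in># p" "even x" "odd y" for x y
      using that q[of x] q[of y] False by (auto simp: p top_part_def)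
    ultimately show ?L
      using False by (auto simp: is_EO_star_def p top_part_def)
  qed
qed

lemma half_top_eq:
  assumes "is_partition p" "p = top_part g + (q + q)"
    and "\<And>x. x \<in># q \<Longrightarrow> even x \<Longrightarrow> x \<le> 2 * g"
  shows "half_top p = g"
proof -
  have "Max (insert 0 {x \<in> set_mset p. even x}) = 2 * g"
    by (rule Max_eqI) (use assms in \<open>auto simp: top_part_def split: if_splits\<close>)
  then show ?thesis by (simp add: half_top_def)
qed

text \<open>
  The map \<open>h\<close> below doubles the multiplicities of the even parts \<open>2 * y\<close> and the odd parts, and
  restores the largest even part.  It is injective because the largest even part determines \<open>g\<close>,
  and the even and the odd parts of the rest determine the two partitions.
\<close>
lemma card_EO_star_partitions_eq_card_decomps:
  "card (EO_star_partitions (2 * n)) = card (decomps bounded_partitions n)"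
proof -
  define core :: "nat multiset \<times> nat multiset \<Rightarrow> nat multiset"
    where "core = (\<lambda>(d, t). image_mset (\<lambda>x. 2 * x) d + t)"
  define h :: "(nat \<times> nat) \<times> nat multiset \<times> nat multiset \<Rightarrow> nat multiset"
    where "h = (\<lambda>((g, j), d, t). top_part g + (core (d, t) + core (d, t)))"
  have sum_top: "sum_mset (top_part g) = 2 * g" for g by (simp add: top_part_def)
  have props: "is_partition (h ((g, j), d, t))" "half_top (h ((g, j), d, t)) = g"
    "sum_mset (h ((g, j), d, t)) = 2 * n" "is_EO_star (h ((g, j), d, t))"
    "filter_mset even (core (d, t)) = image_mset (\<lambda>x. 2 * x) d"
    "filter_mset odd (core (d, t)) = t" "sum_mset d = j"
    if mem: "((g, j), d, t) \<in> decomps bounded_partitions n" for g j d t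
  proof -
    have d: "\<And>x. x \<in># d \<Longrightarrow> 1 \<le> x \<and> x \<le> g" "sum_mset d = j"
      and t: "\<And>x. x \<in># t \<Longrightarrow> odd x \<and> 2 * g < x" and n: "n = g + 2 * j + sum_mset t"
      using mem by (auto simp: mem_decomps bounded_partitions_def odd_partitions_above_def)
    have core: "if even x then x \<le> 2 * g else 2 * g < x" if "x \<in># core (d, t)" for x
      using that d t by (auto simp: core_def)
    show part: "is_partition (h ((g, j), d, t))"
      using d t by (fastforce simp: is_partition_def h_def core_def top_part_def)
    show "half_top (h ((g, j), d, t)) = g"
      by (rule half_top_eq[OF part, of _ "core (d, t)"]) (use core in \<open>auto simp: h_def split: if_splits\<close>)
    show "sum_mset (h ((g, j), d, t)) = 2 * n"
      using d(2) n sum_mset_image_double[of d] by (simp add: h_def core_def sum_top)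
    show "is_EO_star (h ((g, j), d, t))"
      unfolding is_EO_star_iff[OF part] using core
      by (intro exI[of _ g] exI[of _ "core (d, t)"] conjI ballI) (simp_all add: h_def)
    have "filter_mset even t = {#}" "filter_mset odd t = t"
      using t by (simp_all add: filter_mset_eq_conv)
    moreover have "filter_mset even (image_mset (\<lambda>x. 2 * x) d) = image_mset (\<lambda>x. 2 * x) d"
      "filter_mset odd (image_mset (\<lambda>x. 2 * x) d) = {#}"
      by (simp_all add: filter_mset_image_mset)
    ultimately show "filter_mset even (core (d, t)) = image_mset (\<lambda>x. 2 * x) d"
      "filter_mset odd (core (d, t)) = t" by (simp_all add: core_def)
    show "sum_mset d = j" by (fact d(2))
  qed
  have "bij_betw h (decomps bounded_partitions n) (EO_star_partitions (2 * n))"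
  proof (rule bij_betw_imageI)
    show "inj_on h (decomps bounded_partitions n)"
    proof (rule inj_onI)
      fix y z assume y: "y \<in> decomps bounded_partitions n" and z: "z \<in> decomps bounded_partitions n"
        and eq: "h y = h z"
      obtain g j d t where y': "y = ((g, j), d, t)" by (metis prod.exhaust)
      obtain g' j' d' t' where z': "z = ((g', j'), d', t')" by (metis prod.exhaust)
      note py = props[OF y[unfolded y']] and pz = props[OF z[unfolded z']]
      have g: "g = g'" using eq py(2) pz(2) by (simp add: y' z')
      then have "core (d, t) = core (d', t')"
        using eq by (simp add: y' z' h_def double_mset_inject)
      then have "image_mset (\<lambda>x. 2 * x) d = image_mset (\<lambda>x. 2 * x) d'" and t: "t = t'"
        using py(5,6) pz(5,6) by simp_all
      moreover have "inj (\<lambda>x :: nat. 2 * x)" by (simp add: inj_def)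
      ultimately have d: "d = d'" by (meson multiset.inj_map injD)
      show "y = z" using g d t py(7) pz(7) by (simp add: y' z')
    qed
    show "h ` decomps bounded_partitions n = EO_star_partitions (2 * n)"
    proof
      show "h ` decomps bounded_partitions n \<subseteq> EO_star_partitions (2 * n)"
        using props(1,3,4) by (auto simp: EO_star_partitions_def)
      show "EO_star_partitions (2 * n) \<subseteq> h ` decomps bounded_partitions n"
      proof
        fix p assume "p \<in> EO_star_partitions (2 * n)"
        then have part: "is_partition p" and sum: "sum_mset p = 2 * n" and eo: "is_EO_star p"
          by (auto simp: EO_star_partitions_def)
        obtain g q where p: "p = top_part g + (q + q)"
          and q: "\<And>x. x \<in># q \<Longrightarrow> if even x then x \<le> 2 * g else 2 * g < x"
          using eo unfolding is_EO_star_iff[OF part] by blast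
        define d where "d = image_mset (\<lambda>x. x div 2) (filter_mset even q)"
        define t where "t = filter_mset odd q"
        have "image_mset (\<lambda>x. 2 * x) d = image_mset id (filter_mset even q)"
          unfolding d_def image_mset.compositionality by (rule image_mset_cong) auto
        then have core: "core (d, t) = q"
          by (simp add: core_def t_def)
        have n: "n = g + 2 * sum_mset d + sum_mset t"
          using sum sum_mset_image_double[of d] core by (auto simp: p sum_top core_def)
        have "1 \<le> x \<and> x \<le> g" if "x \<in># d" for x
        proof -
          obtain y where y: "y \<in># q" "even y" "x = y div 2" using \<open>x \<in># d\<close> by (auto simp: d_def)
          have "0 < y" using y(1) part by (auto simp: p is_partition_def)
          then show ?thesis using q[OF y(1)] y by (auto elim!: evenE)
        qed
        moreover have "odd x \<and> 2 * g < x" if "x \<in># t" for x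
          using that q[of x] by (auto simp: t_def)
        ultimately have "((g, sum_mset d), d, t) \<in> decomps bounded_partitions n"
          using n by (auto simp: mem_decomps bounded_partitions_def odd_partitions_above_def)
        moreover have "p = h ((g, sum_mset d), d, t)" by (simp add: h_def core p)
        ultimately show "p \<in> h ` decomps bounded_partitions n" by blast
      qed
    qed
  qed
  then show ?thesis by (rule bij_betw_same_card[symmetric])
qed

theorem theorem3p5:
  fixes n :: nat
  shows "cp 1 1 2 n = EO_star (2 * n)"
  unfolding cp_def EO_star_def card_copartitions_eq_card_decomps
    card_EO_star_partitions_eq_card_decomps
  by (simp add: card_decomps finite_sized_msets finite_bounded_partitions card_sized_eq_card_bounded)

end
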